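(* The tropical chromatic number of $\mathbb{R}^3$ is $8$, i.e. $\chi_{\mathrm{tr}}(\mathbb{R}^3)=8$.
   Context: The tropical distance between $\mathbf{x}=(x_1,x_2,x_3)$ and $\mathbf{y}=(y_1,y_2,y_3)$ in $\mathbb{R}^3$ is $$d_{\mathrm{tr}}(\mathbf{x},\mathbf{y}) = \max\Big\{\max_{1\le i\le 3}|x_i-y_i|,\ \max_{1\le i,j\le 3}(x_i-y_i-x_j+y_j)\Big\} = \max\Big\{\max_{1\le i\le 3}(x_i-y_i),0\Big\}-\min\Big\{\min_{1\le i\le 3}(x_i-y_i),0\Big\}.$$ The tropical chromatic number $\chi_{\mathrm{tr}}(\mathbb{R}^3)$ is the minimal number of colors needed to color the points of $\mathbb{R}^3$ in such a way that no two points at tropical distance $1$ from one another have the same color. No measurability or other regularity condition is imposed on the color classes. *)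

theory Defs
  imports "HOL-Analysis.Analysis" "HOL-Library.Extended_Nat"
begin

definition tropical_dist :: "real ^ 'n \<Rightarrow> real ^ 'n \<Rightarrow> real" where
  "tropical_dist x y =
     max (MAX i. \<bar>x $ i - y $ i\<bar>) (MAX (i, j). x $ i - y $ i - x $ j + y $ j)"

lemma tropical_dist_alt:
  fixes x y :: "real ^ 'n"
  shows "tropical_dist x y = max (MAX i. x $ i - y $ i) 0 - min (MIN i. x $ i - y $ i) 0"
proof -
  define z where "z i = x $ i - y $ i" for i
  define A where "A = (MAX i. \<bar>z i\<bar>)"
  define B where "B = (MAX (i, j). z i - z j)"
  define M where "M = (MAX i. z i)"
  define m where "m = (MIN i. z i)"
  have d: "tropical_dist x y = max A B"
    by (simp add: tropical_dist_def A_def B_def z_def algebra_simps)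
  have M: "z i \<le> M" and m: "m \<le> z i" and A: "\<bar>z i\<bar> \<le> A" for i
    by (auto simp: M_def m_def A_def)
  have B: "z i - z j \<le> B" for i j
    unfolding B_def by (rule Max_ge) (auto intro!: image_eqI[of _ _ "(i, j)"])
  have "M \<in> range z" "m \<in> range z" "A \<in> range (\<lambda>i. \<bar>z i\<bar>)"
    by (simp_all add: M_def m_def A_def del: image_iff)
  then obtain p q r where pqr: "M = z p" "m = z q" "A = \<bar>z r\<bar>" by blast
  have "B \<in> range (\<lambda>(i, j). z i - z j)"
    unfolding B_def by (rule Max_in) auto
  then obtain s t where "B = z s - z t" by auto
  with pqr M[of r] m[of r] M[of s] m[of t] A[of p] A[of q] B[of p q]
  have "max A B = max M 0 - min m 0"
    by (auto simp: max_def min_def abs_if split: if_splits)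
  then show ?thesis by (simp add: d M_def m_def z_def)
qed

definition tropically_colorable :: "'n::finite itself \<Rightarrow> nat \<Rightarrow> bool" where
  "tropically_colorable _ k \<longleftrightarrow>
     (\<exists>c :: real ^ 'n \<Rightarrow> nat. (\<forall>x. c x < k) \<and> (\<forall>x y. tropical_dist x y = 1 \<longrightarrow> c x \<noteq> c y))"

text \<open>The value is \<open>\<infinity>\<close> if no finite number of colors suffices.\<close>

definition tropical_chromatic_number :: "'n::finite itself \<Rightarrow> enat" where
  "tropical_chromatic_number T = (INF k \<in> {k. tropically_colorable T k}. enat k)"

end

theory Submission
  imports Defs "HOL-Real_Asymp.Real_Asymp"
begin

text \<open>
  The argument works in every dimension \<open>n\<close> and gives the value \<open>2 ^ n\<close>.  Append a coordinate that is
  constantly \<open>0\<close> (the index \<^term>\<open>None\<close>).  The tropical distance of two points then becomes the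
  spread, maximum minus minimum, of the difference of their \<open>n + 1\<close> coordinates.  The spread ignores
  constant vectors, so all \<open>n + 1\<close> coordinates play the same role.  Rescale by \<open>2\<close>, so that
  the forbidden spread is \<open>2\<close>.

  Upper bound.  The vectors of spread at most \<open>1\<close> form a polytope that tiles space by translation
  along the integer vectors \<open>v\<close> with coordinate sum \<open>0\<close> (for \<open>n = 3\<close>, the rhombic dodecahedra around
  the points of the face-centred cubic lattice).  Colour the tile of \<open>v\<close> by the parities of the
  coordinates of \<open>v\<close>; the parity at \<^term>\<open>None\<close> is determined by the others, so there are \<open>2 ^ n\<close>
  colours.  Two points of one tile differ by a vector of spread at most \<open>2\<close>; the centres of
  two distinct tiles of one colour differ by twice a nonzero integer vector of sum \<open>0\<close>, that is, by a
  vector of spread at least \<open>4\<close>, which leaves spread at least \<open>2\<close> for the points.  Spread exactly \<open>2\<close>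
  is excluded by assigning the boundary points to the tiles by a fixed order of the coordinates
  (\<open>exists_tile_center\<close>, \<open>spread_ne_2_if_same_parity\<close>).

  Lower bound.  Let \<open>A\<close> be a set of integer points without differences of spread \<open>2\<close>.  For each
  \<open>a \<in> A\<close> there is a coordinate \<open>i\<close> at which all the differences \<open>b - a\<close> of spread at most \<open>1\<close>, with
  \<open>b \<in> A\<close>, are maximal (\<open>exists_common_argmax\<close>).  Give to \<open>a\<close> the \<open>2 ^ n\<close> points that are
  obtained by adding \<open>1\<close> to a set of coordinates that does not contain \<open>i\<close>.  The points given to
  distinct elements of \<open>A\<close> are distinct (\<open>eq_if_common_point\<close>), so \<open>A\<close> has density at most \<open>1 / 2 ^ n\<close>.
  Counting in large boxes turns this into the bound for the number of colours.
\<close>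

section \<open>Tropical distance as a spread\<close>

definition spread :: "('a::finite \<Rightarrow> 'b::linordered_idom) \<Rightarrow> 'b" where
  "spread z = Max (range z) - Min (range z)"

lemma spread_ge: "z i - z j \<le> spread z"
  unfolding spread_def by (intro diff_mono) auto

lemma spread_attained: "\<exists>i j. z i - z j = spread z"
proof -
  have "Max (range z) \<in> range z" "Min (range z) \<in> range z"
    by (simp_all del: image_iff)
  then obtain i j where "Max (range z) = z i" "Min (range z) = z j" by blast
  then show ?thesis unfolding spread_def by metis
qed

lemma spread_le_iff: "spread z \<le> d \<longleftrightarrow> (\<forall>i j. z i - z j \<le> d)"
  by (metis spread_ge spread_attained order_trans)

lemma spread_eq_iff: "spread z = d \<longleftrightarrow> (\<forall>i j. z i - z j \<le> d) \<and> (\<exists>i j. z i - z j = d)"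
  by (metis spread_ge spread_attained order_antisym)

lemma exists_argmax:
  fixes z :: "'a::finite \<Rightarrow> 'b::linorder"
  shows "\<exists>i. \<forall>k. z k \<le> z i"
proof -
  have "Max (range z) \<in> range z" by (simp del: image_iff)
  then obtain i where "Max (range z) = z i" by blast
  then show ?thesis by (metis Max_ge finite rangeI finite_imageI)
qed

definition homogeneous :: "real ^ 'n \<Rightarrow> 'n option \<Rightarrow> real" where
  "homogeneous x = case_option 0 (($) x)"

lemma homogeneous_simps [simp]: "homogeneous x None = 0" "homogeneous x (Some i) = x $ i"
  by (simp_all add: homogeneous_def)

lemma tropical_dist_eq_spread:
  fixes x y :: "real ^ 'n"
  shows "tropical_dist x y = spread (\<lambda>i. homogeneous x i - homogeneous y i)"
proof -
  have "range (\<lambda>i. homogeneous x i - homogeneous y i) = insert 0 (range (\<lambda>i. x $ i - y $ i))"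
    by (simp add: UNIV_option_conv image_image)
  then show ?thesis
    by (simp add: tropical_dist_alt spread_def max.commute min.commute)
qed

section \<open>A coloring by parities of lattice tiles\<close>

text \<open>
  The second clause makes the tiles pairwise disjoint: of the boundary points, at which some difference
  of coordinates is \<open>1\<close>, it keeps those where the order given by \<open>h\<close> agrees with the order of the
  values.
\<close>

definition in_tile :: "('a \<Rightarrow> nat) \<Rightarrow> ('a \<Rightarrow> real) \<Rightarrow> bool" where
  "in_tile h z \<longleftrightarrow> (\<forall>i j. z i - z j \<le> 1 \<and> (z i - z j = 1 \<longrightarrow> h j < h i))"

text \<open>
  Lowering the largest coordinate by \<open>1\<close>, and among equal ones the first with respect to \<open>h\<close>, keeps a
  vector in the tile.  This is how one passes from centres of one coordinate sum to the next.
\<close>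

lemma in_tile_decrease_max:
  fixes z :: "'a::finite \<Rightarrow> real"
  assumes h: "inj h" and z: "in_tile h z"
  shows "\<exists>m. in_tile h (\<lambda>i. z i - (if i = m then 1 else 0))"
proof -
  define M where "M = {i. \<forall>k. z k \<le> z i}"
  obtain i where "i \<in> M" using exists_argmax[of z] unfolding M_def by blast
  then obtain m where m: "m \<in> M" and min: "\<And>k. k \<in> M \<Longrightarrow> h m \<le> h k"
    using ex_has_least_nat[of "\<lambda>k. k \<in> M" i h] by blast
  have z_le: "z k \<le> z m" for k using m by (simp add: M_def)
  have first: "h m < h k" if "z k = z m" "k \<noteq> m" for k
  proof -
    have "k \<in> M" using that z_le by (simp add: M_def)
    moreover have "h k \<noteq> h m" using h that by (simp add: inj_eq)
    ultimately show ?thesis using min by (metis le_neq_implies_less)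
  qed
  have "in_tile h (\<lambda>i. z i - (if i = m then 1 else 0))"
    unfolding in_tile_def
  proof (intro allI)
    fix i j
    show "z i - (if i = m then 1 else 0) - (z j - (if j = m then 1 else 0)) \<le> 1 \<and>
      (z i - (if i = m then 1 else 0) - (z j - (if j = m then 1 else 0)) = 1 \<longrightarrow> h j < h i)"
      using z[unfolded in_tile_def, rule_format, of i j] z_le[of i] z_le[of j] first[of i]
      by (cases "i = m"; cases "j = m") auto
  qed
  then show ?thesis ..
qed

lemma exists_tile_center:
  fixes x :: "'a::finite \<Rightarrow> real"
  assumes h: "inj h"
  shows "\<exists>v :: 'a \<Rightarrow> int. (\<Sum>i\<in>UNIV. v i) = 0 \<and> in_tile h (\<lambda>i. x i - of_int (v i))"
proof -
  \<comment> \<open>Subtracting the constant \<open>K\<close> from the integer parts makes their sum nonpositive; from there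
     unit steps lead to sum \<open>0\<close>.\<close>
  define K where "K = \<bar>\<Sum>i\<in>UNIV. \<lfloor>x i\<rfloor>\<bar>"
  define s where "s = (\<Sum>i\<in>UNIV. \<lfloor>x i\<rfloor> - K)"
  have "K * 1 \<le> K * int CARD('a)"
    by (intro mult_left_mono) (auto simp: K_def Suc_le_eq)
  then have s: "s \<le> 0" unfolding s_def by (simp add: sum_subtractf K_def mult.commute)
  have "\<exists>v :: 'a \<Rightarrow> int. (\<Sum>i\<in>UNIV. v i) = s + int k \<and> in_tile h (\<lambda>i. x i - of_int (v i))" for k
  proof (induction k)
    case 0
    have "(x i - of_int (\<lfloor>x i\<rfloor> - K)) - (x j - of_int (\<lfloor>x j\<rfloor> - K)) < 1" for i j
      by simp linarith
    then have "in_tile h (\<lambda>i. x i - of_int (\<lfloor>x i\<rfloor> - K))"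
      unfolding in_tile_def by (metis less_irrefl less_imp_le)
    then show ?case unfolding s_def by (intro exI[of _ "\<lambda>i. \<lfloor>x i\<rfloor> - K"]) simp
  next
    case (Suc k)
    then obtain v :: "'a \<Rightarrow> int" where v: "(\<Sum>i\<in>UNIV. v i) = s + int k"
      and t: "in_tile h (\<lambda>i. x i - of_int (v i))" by blast
    obtain m where m: "in_tile h (\<lambda>i. x i - of_int (v i) - (if i = m then 1 else 0))"
      using in_tile_decrease_max[OF h t] by blast
    have "(\<lambda>i. x i - of_int (v i) - (if i = m then 1 else 0)) =
      (\<lambda>i. x i - of_int (v i + (if i = m then 1 else 0)))" by auto
    with m v show ?case
      by (intro exI[of _ "\<lambda>i. v i + (if i = m then 1 else 0)"]) (simp add: sum.distrib)
  qed
  from this[of "nat (- s)"] s show ?thesis by simp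
qed

lemma exists_pos_if_sum_0:
  fixes f :: "'a::finite \<Rightarrow> int"
  assumes "(\<Sum>i\<in>UNIV. f i) = 0" and "f k \<noteq> 0"
  shows "\<exists>i. f i > 0"
proof (rule ccontr)
  assume "\<not> ?thesis"
  then have le: "f i \<le> 0" for i by (simp add: not_less)
  moreover have "f k < 0" using le[of k] assms(2) by simp
  ultimately have "(\<Sum>i\<in>UNIV. f i) < (\<Sum>i\<in>(UNIV :: 'a set). 0)"
    by (intro sum_strict_mono_ex1) auto
  then show False using assms(1) by simp
qed

text \<open>
  Both in one tile and in two tiles of one colour, spread \<open>2\<close> forces two coordinates \<open>i\<close>, \<open>j\<close> at which
  the two position vectors within the tiles are on opposite boundaries.  The order of \<open>i\<close> and
  \<open>j\<close> cannot allow both.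
\<close>

lemma spread_ne_2_if_same_parity:
  fixes x y :: "'a::finite \<Rightarrow> real" and v w :: "'a \<Rightarrow> int"
  assumes v: "(\<Sum>i\<in>UNIV. v i) = 0" and x: "in_tile h (\<lambda>i. x i - of_int (v i))"
    and w: "(\<Sum>i\<in>UNIV. w i) = 0" and y: "in_tile h (\<lambda>i. y i - of_int (w i))"
    and parity: "\<And>i. even (v i - w i)"
  shows "spread (\<lambda>i. x i - y i) \<noteq> 2"
proof
  assume *: "spread (\<lambda>i. x i - y i) = 2"
  have le: "x i - y i - (x j - y j) \<le> 2" for i j
    using spread_ge[of "\<lambda>i. x i - y i" i j] * by simp
  obtain i0 j0 where eq: "x i0 - y i0 - (x j0 - y j0) = 2"
    using spread_attained[of "\<lambda>i. x i - y i"] * by auto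
  have xt: "x i - v i - (x j - v j) \<le> 1" "x i - v i - (x j - v j) = 1 \<Longrightarrow> h j < h i" for i j
    using x unfolding in_tile_def by auto
  have yt: "y i - w i - (y j - w j) \<le> 1" "y i - w i - (y j - w j) = 1 \<Longrightarrow> h j < h i" for i j
    using y unfolding in_tile_def by auto
  show False
  proof (cases "v = w")
    case True
    have "x i0 - v i0 - (x j0 - v j0) = 1" "y j0 - w j0 - (y i0 - w i0) = 1"
      using eq xt(1)[of i0 j0] yt(1)[of j0 i0] unfolding True by linarith+
    then show False using xt(2)[of i0 j0] yt(2)[of j0 i0] by simp
  next
    case False
    then obtain k where k: "v k - w k \<noteq> 0" by (auto simp: fun_eq_iff)
    have sum0: "(\<Sum>i\<in>UNIV. v i - w i) = 0" using v w by (simp add: sum_subtractf)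
    obtain i where i: "v i - w i > 0"
      using exists_pos_if_sum_0[OF sum0, OF k] by blast
    have "(\<Sum>i\<in>UNIV. w i - v i) = 0" "w k - v k \<noteq> 0"
      using v w k by (simp_all add: sum_subtractf)
    then obtain j where j: "w j - v j > 0"
      using exists_pos_if_sum_0[of "\<lambda>i. w i - v i" k] by blast
    have "v i - w i \<ge> 2" using i parity[of i] by presburger
    moreover have "v j - w j \<le> - 2" using j parity[of j] by presburger
    ultimately have ij: "real_of_int (v i) - w i \<ge> 2" "real_of_int (v j) - w j \<le> - 2" by linarith+
    have "x j - v j - (x i - v i) = 1" "y i - w i - (y j - w j) = 1"
      using ij le[of i j] xt(1)[of j i] yt(1)[of i j] by linarith+
    then show False using xt(2)[of j i] yt(2)[of i j] by simp
  qed
qed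

lemma tropically_colorable_power2: "tropically_colorable TYPE('n::finite) (2 ^ CARD('n))"
proof -
  obtain h :: "'n option \<Rightarrow> nat" where h: "inj h"
    using finite_imp_inj_to_nat_seg[of "UNIV :: 'n option set"] by auto
  obtain e :: "'n set \<Rightarrow> nat" where e: "bij_betw e UNIV {0..<2 ^ CARD('n)}"
    using ex_bij_betw_finite_nat[of "UNIV :: 'n set set"] by (auto simp: card_UNIV_set)
  define r where "r x = (\<lambda>i. 2 * homogeneous x i)" for x :: "real ^ 'n"
  have "\<forall>x. \<exists>v :: 'n option \<Rightarrow> int. (\<Sum>i\<in>UNIV. v i) = 0 \<and> in_tile h (\<lambda>i. r x i - of_int (v i))"
    using exists_tile_center[OF h] by blast
  then obtain v :: "real ^ 'n \<Rightarrow> 'n option \<Rightarrow> int"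
    where v: "\<And>x. (\<Sum>i\<in>UNIV. v x i) = 0" "\<And>x. in_tile h (\<lambda>i. r x i - of_int (v x i))"
    by metis
  define c where "c x = e {i. odd (v x (Some i))}" for x
  have "c x < 2 ^ CARD('n)" for x
    using bij_betwE[OF e] unfolding c_def by auto
  moreover have "tropical_dist x y \<noteq> 1" if "c x = c y" for x y
  proof -
    have "{i. odd (v x (Some i))} = {i. odd (v y (Some i))}"
      using that bij_betw_imp_inj_on[OF e] unfolding c_def by (simp add: inj_eq)
    then have par: "even (v x (Some i) - v y (Some i))" for i by auto
    have "(\<Sum>i\<in>UNIV. v u i) = v u None + (\<Sum>i\<in>UNIV. v u (Some i))" for u
      by (simp add: UNIV_option_conv sum.reindex)
    then have "v u None = - (\<Sum>i\<in>UNIV. v u (Some i))" for u using v(1)[of u] by simp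
    then have "v x None - v y None = - (\<Sum>i\<in>UNIV. v x (Some i) - v y (Some i))"
      by (simp add: sum_subtractf)
    then have "even (v x None - v y None)" using par by (simp add: dvd_sum)
    with par have "even (v x i - v y i)" for i by (cases i) auto
    then have "spread (\<lambda>i. r x i - r y i) \<noteq> 2"
      using spread_ne_2_if_same_parity v by blast
    moreover have "spread (\<lambda>i. r x i - r y i) = 2" if "tropical_dist x y = 1"
    proof -
      have *: "r x i - r y i - (r x j - r y j) =
        2 * (homogeneous x i - homogeneous y i - (homogeneous x j - homogeneous y j))" for i j
        by (simp add: r_def)
      have double: "2 * t \<le> 2 \<longleftrightarrow> t \<le> 1" "2 * t = 2 \<longleftrightarrow> t = 1" for t :: real by auto
      from that show ?thesis unfolding tropical_dist_eq_spread spread_eq_iff * double .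
    qed
    ultimately show ?thesis by blast
  qed
  ultimately show ?thesis unfolding tropically_colorable_def by blast
qed

section \<open>Integer points without differences of spread 2\<close>

text \<open>
  The sets of maximal coordinates of the differences \<open>b - a\<close> form a chain.  Indeed, if neither of two of
  them contained the other, then the difference of the two elements of \<open>A\<close> would have spread \<open>2\<close>.  Hence the
  smallest of these sets is contained in all of them.
\<close>

lemma exists_common_argmax:
  fixes A :: "('a::finite \<Rightarrow> int) set"
  assumes A: "\<And>b c. b \<in> A \<Longrightarrow> c \<in> A \<Longrightarrow> spread (\<lambda>i. b i - c i) \<noteq> 2" and "a \<in> A"
  shows "\<exists>i. \<forall>b\<in>A. spread (\<lambda>i. b i - a i) \<le> 1 \<longrightarrow> (\<forall>k. b k - a k \<le> b i - a i)"
proof -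
  define near where "near b \<longleftrightarrow> b \<in> A \<and> spread (\<lambda>i. b i - a i) \<le> 1" for b
  define D where "D b = {i. \<forall>k. b k - a k \<le> b i - a i}" for b
  have "near a" using \<open>a \<in> A\<close> by (simp add: near_def spread_le_iff)
  then obtain b where b: "near b" and min: "\<And>c. near c \<Longrightarrow> card (D b) \<le> card (D c)"
    using ex_has_least_nat[of near a "\<lambda>b. card (D b)"] by blast
  obtain i where i: "i \<in> D b" using exists_argmax[of "\<lambda>i. b i - a i"] unfolding D_def by blast
  have "D b \<subseteq> D c" if c: "near c" for c
  proof (rule ccontr)
    assume "\<not> D b \<subseteq> D c"
    then obtain p where p: "p \<in> D b" "p \<notin> D c" by blast
    have "\<not> D c \<subset> D b" using min[OF c] by (meson finite leD psubset_card_mono)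
    then obtain q where q: "q \<in> D c" "q \<notin> D b" using p by blast
    have "b q - a q < b p - a p" "c p - a p < c q - a q"
      using p q unfolding D_def by (auto simp: not_le intro: less_le_trans)
    then have "2 \<le> b p - c p - (b q - c q)" by simp
    also have "\<dots> \<le> spread (\<lambda>i. b i - c i)" by (rule spread_ge)
    finally have "2 \<le> spread (\<lambda>i. b i - c i)" .
    moreover have "spread (\<lambda>i. b i - c i) \<le> 2"
      unfolding spread_le_iff
    proof (intro allI)
      fix i j
      show "b i - c i - (b j - c j) \<le> 2"
        using spread_ge[of "\<lambda>i. b i - a i" i j] spread_ge[of "\<lambda>i. c i - a i" j i] b c
        unfolding near_def by linarith
    qed
    ultimately show False using A[of b c] b c unfolding near_def by linarith
  qed
  then have "\<forall>c. near c \<longrightarrow> i \<in> D c" using i by blast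
  then show ?thesis unfolding near_def D_def by auto
qed

text \<open>
  A common point forces \<open>b - a\<close> to have spread at most \<open>1\<close>, so \<open>b - a\<close> is maximal at \<open>i\<close> and minimal at
  \<open>j\<close>.  Passing from \<open>x - a\<close>, minimal at \<open>i\<close>, to \<open>x - b\<close> subtracts at least as much at \<open>i\<close> as at
  \<open>j\<close>; the latter can be minimal at \<open>j\<close> only if \<open>b - a\<close> is constant.
\<close>

lemma eq_if_common_point:
  fixes a b x :: "'a::finite \<Rightarrow> int"
  assumes ab: "spread (\<lambda>k. b k - a k) \<noteq> 2"
    and a: "\<And>k. x k - a k - (x i - a i) \<in> {0, 1}" and b: "\<And>k. x k - b k - (x j - b j) \<in> {0, 1}"
    and i: "spread (\<lambda>k. b k - a k) \<le> 1 \<Longrightarrow> \<forall>k. b k - a k \<le> b i - a i"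
    and j: "spread (\<lambda>k. a k - b k) \<le> 1 \<Longrightarrow> \<forall>k. a k - b k \<le> a j - b j"
    and r: "a r = b r"
  shows "a = b"
proof -
  have a': "0 \<le> x k - a k - (x i - a i)" "x k - a k - (x i - a i) \<le> 1" for k using a[of k] by auto
  have b': "0 \<le> x k - b k - (x j - b j)" "x k - b k - (x j - b j) \<le> 1" for k using b[of k] by auto
  have "b k - a k - (b l - a l) \<le> 2" for k l
    using a'[of k] a'[of l] b'[of k] b'[of l] by linarith
  then have "spread (\<lambda>k. b k - a k) \<le> 2" by (simp add: spread_le_iff)
  with ab have *: "spread (\<lambda>k. b k - a k) \<le> 1" by linarith
  moreover have "spread (\<lambda>k. a k - b k) \<le> 1"
    unfolding spread_le_iff
  proof (intro allI)
    fix k l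
    show "a k - b k - (a l - b l) \<le> 1"
      using spread_ge[of "\<lambda>k. b k - a k" l k] * by linarith
  qed
  ultimately have i': "b k - a k \<le> b i - a i" and j': "a k - b k \<le> a j - b j" for k
    using i j by auto
  show "a = b"
  proof
    fix k
    show "a k = b k"
      using a'(1)[of j] b'(1)[of i] i'[of k] i'[of r] j'[of k] j'[of r] r by linarith
  qed
qed

definition int_box :: "int \<Rightarrow> int \<Rightarrow> ('n::finite option \<Rightarrow> int) set" where
  "int_box l u = (\<Pi>\<^sub>E i\<in>UNIV. if i = None then {0} else {l..u})"

lemma mem_int_box_iff: "p \<in> int_box l u \<longleftrightarrow> p None = 0 \<and> (\<forall>i. l \<le> p (Some i) \<and> p (Some i) \<le> u)"
  unfolding int_box_def by (simp add: PiE_iff split_option_all)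

lemma finite_int_box: "finite (int_box l u)"
  unfolding int_box_def by (intro finite_PiE) auto

lemma card_int_box: "card (int_box l u :: ('n::finite option \<Rightarrow> int) set) = nat (u - l + 1) ^ CARD('n)"
proof -
  have "card (int_box l u :: ('n option \<Rightarrow> int) set) =
      (\<Prod>i\<in>(UNIV :: 'n option set). card (if i = None then {0} else {l..u}))"
    unfolding int_box_def by (intro card_PiE) simp
  then show ?thesis by (simp add: UNIV_option_conv prod.reindex)
qed

lemma card_avoiding_spread_2:
  fixes A :: "('n::finite option \<Rightarrow> int) set"
  assumes A: "\<And>b c. b \<in> A \<Longrightarrow> c \<in> A \<Longrightarrow> spread (\<lambda>i. b i - c i) \<noteq> 2"
    and box: "A \<subseteq> int_box 1 (int N)"
  shows "card A * 2 ^ CARD('n) \<le> (N + 2) ^ CARD('n)"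
proof -
  have "\<forall>a\<in>A. \<exists>i. \<forall>b\<in>A. spread (\<lambda>i. b i - a i) \<le> 1 \<longrightarrow> (\<forall>k. b k - a k \<le> b i - a i)"
    using exists_common_argmax[OF A] by blast
  then obtain i where i: "\<And>a b. a \<in> A \<Longrightarrow> b \<in> A \<Longrightarrow> spread (\<lambda>k. b k - a k) \<le> 1 \<Longrightarrow>
      \<forall>k. b k - a k \<le> b (i a) - a (i a)"
    by metis
  define P where "P = (SIGMA a:A. Pow (UNIV - {i a}))"
  \<comment> \<open>The last summand subtracts a constant vector and restores the coordinate \<open>0\<close> at \<^term>\<open>None\<close>.\<close>
  define f :: "('n option \<Rightarrow> int) \<times> 'n option set \<Rightarrow> 'n option \<Rightarrow> int"
    where "f = (\<lambda>(a, S) k. a k + of_bool (k \<in> S) - of_bool (None \<in> S))"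
  have None: "a None = 0" if "a \<in> A" for a
    using box that by (auto simp: mem_int_box_iff)
  have "inj_on f P"
  proof (rule inj_onI, clarify)
    fix a S b T
    assume aS: "(a, S) \<in> P" and bT: "(b, T) \<in> P" and eq: "f (a, S) = f (b, T)"
    have mem: "a \<in> A" "i a \<notin> S" "b \<in> A" "i b \<notin> T" using aS bT by (auto simp: P_def)
    have "a = b"
    proof (rule eq_if_common_point)
      show "spread (\<lambda>k. b k - a k) \<noteq> 2" using A mem by blast
      show "f (a, S) k - a k - (f (a, S) (i a) - a (i a)) \<in> {0, 1}" for k
        using mem by (simp add: f_def)
      show "f (a, S) k - b k - (f (a, S) (i b) - b (i b)) \<in> {0, 1}" for k
        unfolding eq using mem by (simp add: f_def)
      show "\<forall>k. b k - a k \<le> b (i a) - a (i a)" if "spread (\<lambda>k. b k - a k) \<le> 1"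
        using i that mem by blast
      show "\<forall>k. a k - b k \<le> a (i b) - b (i b)" if "spread (\<lambda>k. a k - b k) \<le> 1"
        using i that mem by blast
      show "a None = b None" using None[OF mem(1)] None[OF mem(3)] by simp
    qed
    moreover have "S = T"
    proof -
      have *: "of_bool (k \<in> S) - of_bool (None \<in> S) = (of_bool (k \<in> T) - of_bool (None \<in> T) :: int)"
        for k
        using fun_cong[OF eq, of k] \<open>a = b\<close> by (simp add: f_def)
      \<comment> \<open>Neither \<open>S\<close> nor \<open>T\<close> contains \<open>i a\<close>, so the constants agree.\<close>
      have "(None \<in> S) = (None \<in> T)"
        using *[of "i a"] mem \<open>a = b\<close> by (auto split: if_splits simp: of_bool_def)
      then have "(k \<in> S) = (k \<in> T)" for k using *[of k] by (simp add: of_bool_eq_iff)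
      then show ?thesis by blast
    qed
    ultimately show "a = b \<and> S = T" by simp
  qed
  moreover have "f ` P \<subseteq> int_box 0 (int N + 1)"
  proof (rule image_subsetI, clarify)
    fix a S assume "(a, S) \<in> P"
    then have a: "a \<in> A" by (simp add: P_def)
    then have "a \<in> int_box 1 (int N)" using box by blast
    then have range: "1 \<le> a (Some k)" "a (Some k) \<le> int N" for k by (simp_all add: mem_int_box_iff)
    have "0 \<le> f (a, S) (Some k)" "f (a, S) (Some k) \<le> int N + 1" for k
      using range[of k] unfolding f_def by (simp_all add: of_bool_def)
    moreover have "f (a, S) None = 0" using None[OF a] by (simp add: f_def)
    ultimately show "f (a, S) \<in> int_box 0 (int N + 1)" by (simp add: mem_int_box_iff)
  qed
  ultimately have "card P \<le> card (int_box 0 (int N + 1) :: ('n option \<Rightarrow> int) set)"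
    using card_inj_on_le finite_int_box by blast
  also have "\<dots> = (N + 2) ^ CARD('n)" by (simp add: card_int_box nat_add_distrib)
  also have "card P = (\<Sum>a\<in>A. card (Pow (UNIV - {i a})))"
    unfolding P_def using finite_subset[OF box finite_int_box] by (intro card_SigmaI) auto
  also have "\<dots> = card A * 2 ^ CARD('n)"
    by (simp add: card_Pow card_Diff_singleton)
  finally show ?thesis .
qed

section \<open>The chromatic number\<close>

lemma tropically_colorable_imp_ge:
  assumes "tropically_colorable TYPE('n::finite) k"
  shows "2 ^ CARD('n) \<le> k"
proof -
  obtain c :: "real ^ 'n \<Rightarrow> nat" where ck: "\<And>x. c x < k"
    and c: "\<And>x y. tropical_dist x y = 1 \<Longrightarrow> c x \<noteq> c y"
    using assms unfolding tropically_colorable_def by blast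
  \<comment> \<open>The integer points correspond to the half-integer points of the original space.\<close>
  define g :: "('n option \<Rightarrow> int) \<Rightarrow> real ^ 'n" where "g p = (\<chi> i. of_int (p (Some i)) / 2)" for p
  have N: "2 ^ CARD('n) * N ^ CARD('n) \<le> k * (N + 2) ^ CARD('n)" for N
  proof -
    define X where "X = (int_box 1 (int N) :: ('n option \<Rightarrow> int) set)"
    define A where "A m = {p \<in> X. c (g p) = m}" for m
    have "card (A m) * 2 ^ CARD('n) \<le> (N + 2) ^ CARD('n)" for m
    proof (rule card_avoiding_spread_2)
      show "A m \<subseteq> int_box 1 (int N)" by (auto simp: A_def X_def)
      fix p q assume pq: "p \<in> A m" "q \<in> A m"
      show "spread (\<lambda>i. p i - q i) \<noteq> 2"
      proof
        assume "spread (\<lambda>i. p i - q i) = 2"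
        then have sp: "\<forall>i j. p i - q i - (p j - q j) \<le> 2" "\<exists>i j. p i - q i - (p j - q j) = 2"
          by (simp_all add: spread_eq_iff)
        have None: "u None = 0" if "u \<in> A m" for u
          using that by (simp add: A_def X_def mem_int_box_iff)
        have hom: "homogeneous (g u) i = of_int (u i) / 2" if "u \<in> A m" for u i
          using None[OF that] by (cases i) (simp_all add: g_def)
        have *: "homogeneous (g p) i - homogeneous (g q) i - (homogeneous (g p) j - homogeneous (g q) j)
            = of_int (p i - q i - (p j - q j)) / 2" for i j
          using pq by (simp add: hom field_simps)
        have "tropical_dist (g p) (g q) = 1"
          unfolding tropical_dist_eq_spread spread_eq_iff *
        proof (intro conjI allI)
          fix i j
          have "p i - q i - (p j - q j) \<le> 2" using sp(1) by blast
          then have "real_of_int (p i - q i - (p j - q j)) \<le> of_int 2" by (simp only: of_int_le_iff)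
          then show "real_of_int (p i - q i - (p j - q j)) / 2 \<le> 1" by simp
        next
          obtain i j where "p i - q i - (p j - q j) = 2" using sp(2) by blast
          then have "real_of_int (p i - q i - (p j - q j)) / 2 = 1" by (simp only: of_int_numeral)
          then show "\<exists>i j. real_of_int (p i - q i - (p j - q j)) / 2 = 1" by blast
        qed
        then show False using c[of "g p" "g q"] pq by (simp add: A_def)
      qed
    qed
    then have le: "(\<Sum>m<k. card (A m) * 2 ^ CARD('n)) \<le> (\<Sum>m<k. (N + 2) ^ CARD('n))"
      by (intro sum_mono)
    have "X = (\<Union>m<k. A m)" using ck by (auto simp: A_def)
    then have "card X \<le> (\<Sum>m<k. card (A m))" using card_UN_le[of "{..<k}" A] by simp
    then have "card X * 2 ^ CARD('n) \<le> (\<Sum>m<k. card (A m)) * 2 ^ CARD('n)" by simp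
    also have "\<dots> \<le> k * (N + 2) ^ CARD('n)" using le by (simp add: sum_distrib_right)
    finally show ?thesis by (simp add: X_def card_int_box mult.commute)
  qed
  have "2 ^ CARD('n) * (real N / (real N + 2)) ^ CARD('n) \<le> real k" for N
  proof -
    have "real (2 ^ CARD('n) * N ^ CARD('n)) \<le> real (k * (N + 2) ^ CARD('n))"
      using N by (simp only: of_nat_le_iff)
    then show ?thesis by (simp add: power_divide divide_le_eq add.commute)
  qed
  moreover have "(\<lambda>N. real N / (real N + 2)) \<longlonglongrightarrow> 1" by real_asymp
  then have "(\<lambda>N. 2 ^ CARD('n) * (real N / (real N + 2)) ^ CARD('n)) \<longlonglongrightarrow> 2 ^ CARD('n) * 1 ^ CARD('n)"
    by (intro tendsto_intros)
  ultimately have "2 ^ CARD('n) * 1 ^ CARD('n) \<le> real k"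
    by (intro LIMSEQ_le_const2) auto
  then have "real (2 ^ CARD('n)) \<le> real k" by simp
  then show ?thesis by (simp only: of_nat_le_iff)
qed

theorem tropical_chromatic_number_eq:
  "tropical_chromatic_number TYPE('n::finite) = enat (2 ^ CARD('n))"
  unfolding tropical_chromatic_number_def
proof (rule antisym)
  show "(INF k \<in> {k. tropically_colorable TYPE('n) k}. enat k) \<le> enat (2 ^ CARD('n))"
    using tropically_colorable_power2 by (intro INF_lower) simp
  show "enat (2 ^ CARD('n)) \<le> (INF k \<in> {k. tropically_colorable TYPE('n) k}. enat k)"
    using tropically_colorable_imp_ge by (intro INF_greatest) simp
qed

theorem theorem5p1: "tropical_chromatic_number TYPE(3) = 8"
  by (simp add: tropical_chromatic_number_eq numeral_eq_enat)

end
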